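(* For every $c \ge 3$ there exists a family $\mathcal{F}$ of pairs $(P, L)$, where $P$ is a partial order on a ground set $X$ of $n$ elements and $L$ is a linear extension of $P$, such that there exists no algorithm that for more than a quarter of the pairs $(P, L) \in \mathcal{F}$ can preprocess $P$ using $\frac{1}{48} \cdot n^{1+\frac{1}{c}}$ partial oracle queries and then recover $L$ using $\frac{1}{73} \cdot c \log e(P)$ exact and partial oracle queries.
   Context: A partial oracle $O_P$ answers, for any ordered pair $(x_i,x_j)$ of distinct elements of $X$, whether $x_i \prec_P x_j$. An exact (linear) oracle $O_L$ answers, for any pair $(x_i,x_j)$, whether $x_i <_L x_j$. The algorithm has a preprocessing phase that only accesses $O_P$, followed by a recovery phase in which it may access $O_L$ (and $O_P$). A linear extension of $P$ is a linear order $L$ with $x_i <_L x_j$ whenever $x_i \prec_P x_j$; $e(P)$ is the number of linear extensions of $P$, and $\log$ is base $2$. *)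

theory Defs
  imports Complex_Main
begin

text \<open>
  Orders are the library's reflexive ones; \<open>x \<prec>\<^sub>P y\<close> and \<open>x <\<^sub>L y\<close> are membership in the strict parts
  \<open>P - Id\<close> and \<open>L - Id\<close>.
\<close>

definition linear_extensions :: "'a set \<Rightarrow> 'a rel \<Rightarrow> 'a rel set" where
  "linear_extensions X P = {L. linear_order_on X L \<and> P - Id \<subseteq> L - Id}"

definition num_linear_extensions :: "'a set \<Rightarrow> 'a rel \<Rightarrow> nat" where
  "num_linear_extensions X P = card (linear_extensions X P)"

definition instances :: "'a set \<Rightarrow> ('a rel \<times> 'a rel) set" where
  "instances X = {(P, L). partial_order_on X P \<and> L \<in> linear_extensions X P}"

text \<open>
  A deterministic algorithm is an adaptive decision tree, which places no bound on time or memory.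
  The first subtree of a query node is taken on answer ``yes'', the second on answer ``no''.
  A preprocessing tree has recovery trees as its leaves, so everything learnt while preprocessing
  is available in the recovery phase, whose leaves carry the reported linear order.
\<close>

datatype 'a recovery =
    Report "'a rel"
  | Ask_Partial 'a 'a "'a recovery" "'a recovery"
  | Ask_Linear 'a 'a "'a recovery" "'a recovery"

datatype 'a algorithm =
    Recover "'a recovery"
  | Preprocess 'a 'a "'a algorithm" "'a algorithm"

primrec recovery_on :: "'a set \<Rightarrow> 'a recovery \<Rightarrow> bool" where
  "recovery_on X (Report R) \<longleftrightarrow> True"
| "recovery_on X (Ask_Partial x y s t) \<longleftrightarrow>
     x \<in> X \<and> y \<in> X \<and> x \<noteq> y \<and> recovery_on X s \<and> recovery_on X t"
| "recovery_on X (Ask_Linear x y s t) \<longleftrightarrow>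
     x \<in> X \<and> y \<in> X \<and> recovery_on X s \<and> recovery_on X t"

primrec algorithm_on :: "'a set \<Rightarrow> 'a algorithm \<Rightarrow> bool" where
  "algorithm_on X (Recover r) \<longleftrightarrow> recovery_on X r"
| "algorithm_on X (Preprocess x y s t) \<longleftrightarrow>
     x \<in> X \<and> y \<in> X \<and> x \<noteq> y \<and> algorithm_on X s \<and> algorithm_on X t"

primrec preprocessing_queries :: "'a rel \<Rightarrow> 'a algorithm \<Rightarrow> nat" where
  "preprocessing_queries P (Recover r) = 0"
| "preprocessing_queries P (Preprocess x y s t) =
     Suc (if (x, y) \<in> P - Id then preprocessing_queries P s else preprocessing_queries P t)"

primrec preprocessed :: "'a rel \<Rightarrow> 'a algorithm \<Rightarrow> 'a recovery" where
  "preprocessed P (Recover r) = r"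
| "preprocessed P (Preprocess x y s t) =
     (if (x, y) \<in> P - Id then preprocessed P s else preprocessed P t)"

primrec recovery_queries :: "'a rel \<Rightarrow> 'a rel \<Rightarrow> 'a recovery \<Rightarrow> nat" where
  "recovery_queries P L (Report R) = 0"
| "recovery_queries P L (Ask_Partial x y s t) =
     Suc (if (x, y) \<in> P - Id then recovery_queries P L s else recovery_queries P L t)"
| "recovery_queries P L (Ask_Linear x y s t) =
     Suc (if (x, y) \<in> L - Id then recovery_queries P L s else recovery_queries P L t)"

primrec recovered :: "'a rel \<Rightarrow> 'a rel \<Rightarrow> 'a recovery \<Rightarrow> 'a rel" where
  "recovered P L (Report R) = R"
| "recovered P L (Ask_Partial x y s t) =
     (if (x, y) \<in> P - Id then recovered P L s else recovered P L t)"
| "recovered P L (Ask_Linear x y s t) =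
     (if (x, y) \<in> L - Id then recovered P L s else recovered P L t)"

definition solves_within :: "real \<Rightarrow> real \<Rightarrow> 'a algorithm \<Rightarrow> 'a rel \<Rightarrow> 'a rel \<Rightarrow> bool" where
  "solves_within a b A P L \<longleftrightarrow>
     real (preprocessing_queries P A) \<le> a \<and>
     real (recovery_queries P L (preprocessed P A)) \<le> b \<and>
     recovered P L (preprocessed P A) = L"

end

theory Submission
  imports Defs "HOL-Combinatorics.Permutations"
begin

text \<open>
  Fix \<open>w \<approx> n\<^bsup>2/c\<^esup>\<close>. For a permutation of \<open>n\<close> elements, read as an assignment of positions, let \<open>L\<close> be the
  order of the positions and let \<open>P\<close> keep only the comparisons between positions that agree
  modulo \<open>w\<close>. Then \<open>P\<close> is a union of \<open>w\<close> chains, so \<open>log e(P) \<le> n log w \<approx> (2/c) n log n\<close>.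

  Call an element touched if it occurs in a preprocessing query about a \<open>P\<close>-comparable pair. A query about
  an untouched element has chance only about \<open>1/w\<close> of meeting a comparable pair, whatever is known
  about the elements touched before; hence \<open>n\<^bsup>1+1/c\<^esup>\<close> queries touch more than \<open>n/4\<close> elements only
  for a tiny fraction of the permutations. Otherwise the outcome of preprocessing is determined by
  the positions of at most \<open>n/4\<close> elements, which leaves at most \<open>2\<^bsup>n\<^esup> n\<^bsup>n/4\<^esup>\<close> outcomes, and \<open>q\<close> recovery
  queries distinguish at most \<open>2\<^bsup>q\<^esup>\<close> orders after each. As \<open>q \<le> (c/73) n log w\<close>, this is far less than \<open>n!\<close>.
\<close>

section \<open>Counting the linear extensions of a union of few chains\<close>

lemma linear_order_on_has_least:
  assumes "finite X" "X \<noteq> {}" "linear_order_on X L"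
  obtains m where "m \<in> X" "\<And>y. y \<in> X \<Longrightarrow> (m, y) \<in> L"
proof -
  have L: "L \<subseteq> X \<times> X" "refl_on X L" "total_on X L" "partial_order_on X L"
    using assms(3) by (auto simp: order_on_defs)
  have "wf (L - Id)"
    using L assms(1) by (meson finite_SigmaI finite_subset partial_order_on_well_order_on)
  then obtain m where m: "m \<in> X" "\<And>y. (y, m) \<in> L - Id \<Longrightarrow> y \<notin> X"
    using assms(2) by (metis wf_eq_minimal all_not_in_conv)
  have "(m, y) \<in> L" if "y \<in> X" for y
    using L m(1) m(2)[of y] that by (cases "y = m") (auto simp: total_on_def refl_on_def)
  with m show thesis using that by blast
qed

lemma linear_order_on_diff:
  assumes "linear_order_on X L"
  shows "linear_order_on (X - A) (L \<inter> (X - A) \<times> (X - A))"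
  using assms unfolding order_on_defs refl_on_def total_on_def trans_def antisym_def by blast

lemma finite_linear_extensions:
  assumes "finite X"
  shows "finite (linear_extensions X P)"
  by (rule finite_subset[of _ "Pow (X \<times> X)"])
    (use assms in \<open>auto simp: linear_extensions_def order_on_defs\<close>)

text \<open>The least element of an extension is minimal in \<open>P\<close>. Minimal elements have
  pairwise distinct \<open>g\<close>-values, since equal values force comparability, so there are at
  most \<open>w\<close> choices; deleting the chosen element leaves an extension of the
  rest.\<close>

lemma card_linear_extensions_le:
  assumes "finite X" "card (g ` X) \<le> w"
    and "\<And>x y. x \<in> X \<Longrightarrow> y \<in> X \<Longrightarrow> g x = g y \<Longrightarrow> x \<noteq> y \<Longrightarrow> (x, y) \<in> P \<or> (y, x) \<in> P"
  shows "card (linear_extensions X P) \<le> w ^ card X"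
proof -
  \<comment> \<open>\<open>P\<close> is cut down to \<open>Y\<close> because its strict pairs that
    leave \<open>Y\<close> could not be contained in an order on \<open>Y\<close>.\<close>
  define E where "E Y = linear_extensions Y (P \<inter> Y \<times> Y)" for Y
  have "card (E X) \<le> w ^ card X"
    using assms
  proof (induction X rule: finite_remove_induct)
    case empty
    have "E {} \<subseteq> {{}}"
      by (auto simp: E_def linear_extensions_def order_on_defs)
    then show ?case using card_mono[of "{{}}" "E {}"] by simp
  next
    case (remove X)
    define M where "M = {m \<in> X. \<forall>y\<in>X. (y, m) \<in> P \<longrightarrow> y = m}"
    define B where "B L m \<longleftrightarrow> m \<in> X \<and> (\<forall>y\<in>X. (m, y) \<in> L)" for L m
    define h where "h L = (SOME m. B L m)" for L
    \<comment> \<open>An extension is encoded by its least element and the induced order on the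
      rest. The code is injective because the least element lies below everything.\<close>
    define r where "r L = (let Y = X - {h L} in (h L, L \<inter> Y \<times> Y))" for L :: "'a rel"
    have h: "B L (h L)" if "L \<in> E X" for L
    proof -
      have "linear_order_on X L" using that by (auto simp: E_def linear_extensions_def)
      then obtain m where "B L m"
        using linear_order_on_has_least[OF \<open>finite X\<close> \<open>X \<noteq> {}\<close>] unfolding B_def by metis
      then show ?thesis unfolding h_def by (rule someI)
    qed
    have "inj_on r (E X)"
    proof (rule inj_onI)
      fix L L' assume L: "L \<in> E X" "L' \<in> E X" "r L = r L'"
      have rec: "L = {h L} \<times> X \<union> L \<inter> (X - {h L}) \<times> (X - {h L})" if "L \<in> E X" for L
      proof -
        have "L \<subseteq> X \<times> X" "antisym L"
          using that by (auto simp: E_def linear_extensions_def order_on_defs)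
        with h[OF that] show ?thesis unfolding B_def by (auto simp: antisym_def)
      qed
      show "L = L'"
        using rec[OF L(1)] rec[OF L(2)] L(3) unfolding r_def Let_def by (metis prod.inject)
    qed
    moreover have "r ` E X \<subseteq> Sigma M (\<lambda>m. E (X - {m}))"
    proof (intro image_subsetI)
      fix L assume L: "L \<in> E X"
      have lin: "linear_order_on X L" and ext: "P \<inter> X \<times> X - Id \<subseteq> L - Id"
        using L by (auto simp: E_def linear_extensions_def)
      have "antisym L" using lin by (simp add: order_on_defs)
      then have "y = h L" if "y \<in> X" "(y, h L) \<in> P" for y
        using h[OF L] ext that unfolding B_def antisym_def by blast
      then have "h L \<in> M"
        using h[OF L] by (simp add: B_def M_def)
      moreover have "L \<inter> (X - {h L}) \<times> (X - {h L}) \<in> E (X - {h L})"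
        using linear_order_on_diff[OF lin, of "{h L}"] ext
        unfolding E_def linear_extensions_def by blast
      ultimately show "r L \<in> Sigma M (\<lambda>m. E (X - {m}))"
        by (simp add: r_def Let_def)
    qed
    moreover have fM: "finite M" using remove.hyps by (simp add: M_def)
    moreover have "finite (E Y)" if "Y \<subseteq> X" for Y
      using that remove.hyps by (simp add: E_def finite_linear_extensions finite_subset)
    ultimately have "card (E X) \<le> card (Sigma M (\<lambda>m. E (X - {m})))"
      by (intro card_inj_on_le) auto
    also have "\<dots> = (\<Sum>m\<in>M. card (E (X - {m})))"
      using fM \<open>\<And>Y. Y \<subseteq> X \<Longrightarrow> finite (E Y)\<close> by (intro card_SigmaI) auto
    also have "\<dots> \<le> (\<Sum>m\<in>M. w ^ (card X - 1))"
    proof (intro sum_mono)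
      fix m assume "m \<in> M"
      then have m: "m \<in> X" by (simp add: M_def)
      have "card (g ` (X - {m})) \<le> w"
        using remove.prems(1) remove.hyps card_mono[of "g ` X" "g ` (X - {m})"] by fastforce
      then show "card (E (X - {m})) \<le> w ^ (card X - 1)"
        using remove.IH[OF m] remove.prems remove.hyps m by simp
    qed
    also have "\<dots> \<le> w * w ^ (card X - 1)"
    proof -
      have "inj_on g M"
        using remove.prems(2) unfolding inj_on_def M_def by blast
      then have "card M = card (g ` M)" by (simp add: card_image)
      also have "\<dots> \<le> card (g ` X)"
        using remove.hyps by (intro card_mono) (auto simp: M_def)
      finally show ?thesis using remove.prems(1) by simp
    qed
    also have "\<dots> = w ^ card X"
      using remove.hyps by (cases "card X") auto
    finally show ?case .
  qed
  moreover have "card (linear_extensions X P) \<le> card (E X)"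
    unfolding E_def using assms(1)
    by (intro card_mono finite_linear_extensions) (auto simp: linear_extensions_def)
  ultimately show ?thesis by linarith
qed

section \<open>Leaves within reach of a recovery tree\<close>

text \<open>The tree may be arbitrarily large, but at most \<open>2 ^ k\<close> leaves lie at depth
  at most \<open>k\<close>. Letting \<open>P\<close> and \<open>L\<close> range over all relations
  makes the induction hypothesis apply to both subtrees, whatever was answered above them.\<close>

lemma card_recovered_le:
  defines "S r k \<equiv> {recovered P L r | P L. recovery_queries P L r \<le> k}"
  shows "finite (S r k) \<and> card (S r k) \<le> 2 ^ k"
proof (induction r arbitrary: k)
  case (Report R)
  have "S (Report R) k \<subseteq> {R}" by (auto simp: S_def)
  then show ?case
    using card_mono[of "{R}" "S (Report R) k"] finite_subset[of "S (Report R) k" "{R}"]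
    by (auto intro: order_trans[of _ 1])
next
  case (Ask_Partial x y s t)
  show ?case
  proof (cases k)
    case 0
    then have "S (Ask_Partial x y s t) k = {}" by (auto simp: S_def)
    then show ?thesis by simp
  next
    case (Suc l)
    have sub: "S (Ask_Partial x y s t) k \<subseteq> S s l \<union> S t l"
      by (fastforce simp: S_def Suc split: if_splits)
    have "card (S (Ask_Partial x y s t) k) \<le> card (S s l \<union> S t l)"
      using sub Ask_Partial by (intro card_mono) auto
    also have "\<dots> \<le> 2 ^ l + 2 ^ l"
      using Ask_Partial[of l] card_Un_le[of "S s l" "S t l"] by linarith
    finally show ?thesis
      using sub Ask_Partial Suc by (auto intro: finite_subset)
  qed
next
  case (Ask_Linear x y s t)
  show ?case
  proof (cases k)
    case 0
    then have "S (Ask_Linear x y s t) k = {}" by (auto simp: S_def)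
    then show ?thesis by simp
  next
    case (Suc l)
    have sub: "S (Ask_Linear x y s t) k \<subseteq> S s l \<union> S t l"
      by (fastforce simp: S_def Suc split: if_splits)
    have "card (S (Ask_Linear x y s t) k) \<le> card (S s l \<union> S t l)"
      using sub Ask_Linear by (intro card_mono) auto
    also have "\<dots> \<le> 2 ^ l + 2 ^ l"
      using Ask_Linear[of l] card_Un_le[of "S s l" "S t l"] by linarith
    finally show ?thesis
      using sub Ask_Linear Suc by (auto intro: finite_subset)
  qed
qed

section \<open>What preprocessing learns\<close>

primrec touched :: "'a rel \<Rightarrow> 'a algorithm \<Rightarrow> 'a set" where
  "touched P (Recover r) = {}"
| "touched P (Preprocess x y s t) =
     (if (x, y) \<in> P \<or> (y, x) \<in> P then {x, y} else {}) \<union>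
     (if (x, y) \<in> P - Id then touched P s else touched P t)"

lemma touched_subset: "algorithm_on X A \<Longrightarrow> touched P A \<subseteq> X"
  by (induction A) auto

text \<open>Every query answered \<open>yes\<close> on the path has both its elements in
  \<open>S\<close>, so it keeps its answer when the pairs outside \<open>S\<close> are deleted;
  deletion cannot affect an answer \<open>no\<close>.\<close>

lemma preprocessed_restrict:
  "touched P A \<subseteq> S \<Longrightarrow> preprocessed (P \<inter> S \<times> S) A = preprocessed P A"
  by (induction A) (auto split: if_splits)

section \<open>The hard instances\<close>

text \<open>Positions may coincide. Only injective \<open>f\<close> give instances, but touched
  elements are counted over all maps, where the positions of different elements can be chosen
  independently.\<close>

definition position_order :: "'a set \<Rightarrow> ('a \<Rightarrow> nat) \<Rightarrow> 'a rel" where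
  "position_order X f = {(x, y). x \<in> X \<and> y \<in> X \<and> f x \<le> f y}"

definition chain_order :: "nat \<Rightarrow> 'a set \<Rightarrow> ('a \<Rightarrow> nat) \<Rightarrow> 'a rel" where
  "chain_order w X f = {(x, y) \<in> position_order X f. f x mod w = f y mod w}"

lemma chain_order_iff:
  "(x, y) \<in> chain_order w X f \<longleftrightarrow> x \<in> X \<and> y \<in> X \<and> f x \<le> f y \<and> f x mod w = f y mod w"
  by (auto simp: chain_order_def position_order_def)

lemma chain_order_Int: "S \<subseteq> X \<Longrightarrow> chain_order w X f \<inter> S \<times> S = chain_order w S f"
  by (auto simp: chain_order_iff)

lemma chain_order_restrict [simp]: "chain_order w X (restrict f X) = chain_order w X f"
  by (auto simp: chain_order_iff)

lemma position_order_restrict [simp]: "position_order X (restrict f X) = position_order X f"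
  by (auto simp: position_order_def)

lemma chain_position_in_instances:
  assumes "inj_on f X"
  shows "(chain_order w X f, position_order X f) \<in> instances X"
proof -
  have "antisym (position_order X f)"
    using assms by (auto simp: position_order_def antisym_def inj_on_def)
  then have "antisym (chain_order w X f)"
    by (auto simp: chain_order_def antisym_def)
  moreover have "trans (position_order X f)"
    by (auto simp: position_order_def trans_def)
  moreover have "trans (chain_order w X f)"
    by (rule transI) (auto simp: chain_order_iff)
  moreover have "total_on X (position_order X f)"
    by (auto simp: position_order_def total_on_def)
  moreover have "refl_on X (position_order X f)" "refl_on X (chain_order w X f)"
    by (auto simp: position_order_def refl_on_def chain_order_iff)
  moreover have "position_order X f \<subseteq> X \<times> X" "chain_order w X f \<subseteq> X \<times> X"
    by (auto simp: position_order_def chain_order_iff)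
  moreover have "chain_order w X f \<subseteq> position_order X f"
    by (auto simp: chain_order_def)
  ultimately show ?thesis
    using \<open>antisym (position_order X f)\<close>
    by (auto simp: instances_def linear_extensions_def order_on_defs)
qed

lemma card_linear_extensions_chain_order_le:
  assumes "finite X" "w > 0"
  shows "card (linear_extensions X (chain_order w X f)) \<le> w ^ card X"
proof (rule card_linear_extensions_le[where g = "\<lambda>x. f x mod w"])
  have "(\<lambda>x. f x mod w) ` X \<subseteq> {..<w}" using assms by auto
  then show "card ((\<lambda>x. f x mod w) ` X) \<le> w"
    using card_mono[of "{..<w}"] by simp
qed (use assms in \<open>auto simp: chain_order_iff\<close>)

section \<open>Counting the outcomes of preprocessing\<close>

text \<open>Cutting \<open>chain_order w X f\<close> down to the touched set \<open>S\<close> gives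
  \<open>chain_order w S f\<close>, so the outcome is a function of \<open>S\<close> and of
  \<open>f\<close> on \<open>S\<close>. There are at most \<open>2 ^ card X\<close> such sets, with
  at most \<open>n ^ s\<close> assignments on each.\<close>

lemma card_preprocessed_le:
  fixes s w :: nat
  assumes "finite X" "algorithm_on X A" "n > 0"
  defines "R \<equiv> {preprocessed (chain_order w X f) A | f.
                 f \<in> X \<rightarrow>\<^sub>E {..<n} \<and> card (touched (chain_order w X f) A) \<le> s}"
  shows "finite R" "card R \<le> 2 ^ card X * n ^ s"
proof -
  define D where "D = Sigma {S \<in> Pow X. card S \<le> s} (\<lambda>S. S \<rightarrow>\<^sub>E {..<n})"
  have finS: "finite S" if "S \<subseteq> X" for S using that assms(1) finite_subset by blast
  have fD: "finite D"
    using assms(1) unfolding D_def by (intro finite_SigmaI) (auto intro!: finite_PiE finS)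
  have sub: "R \<subseteq> (\<lambda>(S, g). preprocessed (chain_order w S g) A) ` D"
  proof
    fix r assume "r \<in> R"
    then obtain f where f: "r = preprocessed (chain_order w X f) A" "f \<in> X \<rightarrow>\<^sub>E {..<n}"
      "card (touched (chain_order w X f) A) \<le> s" by (auto simp: R_def)
    define S where "S = touched (chain_order w X f) A"
    have S: "S \<subseteq> X" unfolding S_def using assms(2) by (rule touched_subset)
    have "r = preprocessed (chain_order w S (restrict f S)) A"
      using f(1) preprocessed_restrict[of "chain_order w X f" A S] chain_order_Int[OF S, of w f]
      by (simp add: S_def)
    moreover have "(S, restrict f S) \<in> D"
      using f S by (auto simp: D_def S_def PiE_iff)
    ultimately show "r \<in> (\<lambda>(S, g). preprocessed (chain_order w S g) A) ` D"
      by force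
  qed
  show "finite R" using sub fD finite_surj by blast
  have "card R \<le> card D" using sub fD by (rule surj_card_le[rotated])
  also have "\<dots> = (\<Sum>S\<in>{S \<in> Pow X. card S \<le> s}. n ^ card S)"
    unfolding D_def using assms(1)
    by (subst card_SigmaI) (auto intro!: finite_PiE finS sum.cong simp: card_PiE finS)
  also have "\<dots> \<le> (\<Sum>S\<in>{S \<in> Pow X. card S \<le> s}. n ^ s)"
    using assms(3) by (intro sum_mono power_increasing) auto
  also have "\<dots> \<le> (\<Sum>S\<in>Pow X. n ^ s)"
    using assms(1) by (intro sum_mono2) auto
  also have "\<dots> = 2 ^ card X * n ^ s" by (simp add: card_Pow assms(1))
  finally show "card R \<le> 2 ^ card X * n ^ s" .
qed

section \<open>A tail bound for the number of touched elements\<close>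

text \<open>A residue class contains at most \<open>n div w + 1\<close> of the positions. As
  \<open>w \<le> n\<close>, the extra 1 is at most \<open>n / w\<close>, which explains the factor
  2.\<close>

lemma card_chain_class_le:
  assumes "0 < w" "w \<le> n"
  shows "real (card {v \<in> {..<n}. v mod w = r}) \<le> 2 / real w * real n"
proof -
  have "{v \<in> {..<n}. v mod w = r} \<subseteq> (\<lambda>q. q * w + r) ` {..n div w}"
  proof
    fix v assume v: "v \<in> {v \<in> {..<n}. v mod w = r}"
    then have "v = v div w * w + r" "v div w \<le> n div w" by (auto intro: div_le_mono)
    then show "v \<in> (\<lambda>q. q * w + r) ` {..n div w}" by blast
  qed
  then have "card {v \<in> {..<n}. v mod w = r} \<le> card {..n div w}"
    by (rule surj_card_le[rotated]) simp
  then have "real (card {v \<in> {..<n}. v mod w = r}) \<le> real (n div w) + 1" by simp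
  also have "\<dots> \<le> real n / real w + real n / real w"
    using assms of_nat_div_le_of_nat[of n w, where 'a = real] by (intro add_mono) auto
  finally show ?thesis by (simp add: field_simps)
qed

lemma card_PiE_agreeing_le:
  assumes "finite X" "finite V"
  shows "card {f \<in> X \<rightarrow>\<^sub>E V. \<forall>x\<in>K. f x = k x} \<le> card V ^ card (X - K)"
proof -
  have "inj_on (\<lambda>f. restrict f (X - K)) {f \<in> X \<rightarrow>\<^sub>E V. \<forall>x\<in>K. f x = k x}"
  proof (rule inj_onI)
    fix f g assume fg: "f \<in> {f \<in> X \<rightarrow>\<^sub>E V. \<forall>x\<in>K. f x = k x}" "g \<in> {f \<in> X \<rightarrow>\<^sub>E V. \<forall>x\<in>K. f x = k x}"
      "restrict f (X - K) = restrict g (X - K)"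
    have "f x = g x" if "x \<in> X" for x
    proof -
      have "restrict f (X - K) x = restrict g (X - K) x" using fg(3) by simp
      then show ?thesis
        using fg(1,2) that by (cases "x \<in> K") auto
    qed
    then show "f = g"
      using fg(1,2) by (intro PiE_ext[of f X "\<lambda>_. V" g]) auto
  qed
  then have "card {f \<in> X \<rightarrow>\<^sub>E V. \<forall>x\<in>K. f x = k x} \<le> card ((X - K) \<rightarrow>\<^sub>E V)"
    using assms by (intro card_inj_on_le) (auto intro!: finite_PiE)
  then show ?thesis using assms by (simp add: card_PiE)
qed

text \<open>At least one of \<open>x\<close> and \<open>y\<close> is not yet revealed, and whatever
  the position of the other, at most a fraction \<open>p\<close> of the positions lie in the same
  class. The case distinction tracks whether the exponent drops by one or by two.\<close>

lemma card_agreeing_classes_le: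
  fixes p :: real and V :: "'b set" and k :: "'a \<Rightarrow> 'b" and col :: "'b \<Rightarrow> 'c"
  assumes "finite V" "finite X" "K \<subseteq> X" "x \<in> X" "y \<in> X" "x \<noteq> y" "\<not> (x \<in> K \<and> y \<in> K)"
    and "\<And>r. real (card {v \<in> V. col v = r}) \<le> p * real (card V)"
  defines "C \<equiv> {(u, v) \<in> V \<times> V. col u = col v \<and> (x \<in> K \<longrightarrow> u = k x) \<and> (y \<in> K \<longrightarrow> v = k y)}"
  shows "real (card C) * real (card V) ^ card (X - insert x (insert y K)) \<le> p * real (card V) ^ card (X - K)"
proof -
  define Y where "Y = X - insert x (insert y K)"
  have Y: "finite Y" "x \<notin> Y" "y \<notin> Y" using assms(2) by (auto simp: Y_def)
  consider "x \<notin> K" "y \<notin> K" | "x \<in> K" "y \<notin> K" | "x \<notin> K" "y \<in> K" using assms(7) by blast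
  then show ?thesis
  proof cases
    case 1
    have "C = Sigma V (\<lambda>u. {v \<in> V. col v = col u})" using 1 by (auto simp: C_def)
    then have "real (card C) = (\<Sum>u\<in>V. real (card {v \<in> V. col v = col u}))"
      using assms(1) by simp
    also have "\<dots> \<le> (\<Sum>u\<in>V. p * real (card V))" by (intro sum_mono assms(8))
    finally have C: "real (card C) \<le> p * real (card V) ^ 2" by (simp add: power2_eq_square mult_ac)
    have "X - K = insert x (insert y Y)" using 1 assms(4,5) unfolding Y_def by blast
    then have "card (X - K) = card Y + 2"
      using Y assms(6) by simp
    then show ?thesis
      unfolding Y_def[symmetric]
      using mult_right_mono[OF C, of "real (card V) ^ card Y"]
      by (simp add: power2_eq_square mult_ac)
  next
    case 2
    have "C \<subseteq> Pair (k x) ` {v \<in> V. col v = col (k x)}" using 2 by (auto simp: C_def)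
    then have "card C \<le> card {v \<in> V. col v = col (k x)}" using assms(1) by (auto intro: surj_card_le)
    then have C: "real (card C) \<le> p * real (card V)" using assms(8) by (meson of_nat_mono order_trans)
    have "X - K = insert y Y" using 2 assms(4,5) unfolding Y_def by blast
    then have "card (X - K) = card Y + 1"
      using Y assms(6) by simp
    then show ?thesis
      unfolding Y_def[symmetric]
      using mult_right_mono[OF C, of "real (card V) ^ card Y"]
      by (simp add: mult_ac)
  next
    case 3
    have "C \<subseteq> (\<lambda>u. (u, k y)) ` {v \<in> V. col v = col (k y)}" using 3 by (auto simp: C_def)
    then have "card C \<le> card {v \<in> V. col v = col (k y)}" using assms(1) by (auto intro: surj_card_le)
    then have C: "real (card C) \<le> p * real (card V)" using assms(8) by (meson of_nat_mono order_trans)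
    have "X - K = insert x Y" using 3 assms(4,5) unfolding Y_def by blast
    then have "card (X - K) = card Y + 1"
      using Y assms(6) by simp
    then show ?thesis
      unfolding Y_def[symmetric]
      using mult_right_mono[OF C, of "real (card V) ^ card Y"]
      by (simp add: mult_ac)
  qed
qed

text \<open>
  An exponential moment of the number of touched elements. The set \<open>K\<close> of elements whose positions
  \<open>k\<close> are already revealed makes the induction over the decision tree possible: one query touches at
  most two new elements (factor \<open>z\<^sup>2\<close>), and does so on a fraction of at most \<open>p\<close> of the assignments.
\<close>

lemma sum_power_card_touched_le:
  fixes z p :: real
  assumes z: "z \<ge> 1" and "p \<ge> 0" and X: "finite X" and V: "finite V"
    and p: "\<And>r. real (card {v \<in> V. v mod w = r}) \<le> p * real (card V)"
    and "algorithm_on X A" "K \<subseteq> X"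
  shows "(\<Sum>f | f \<in> X \<rightarrow>\<^sub>E V \<and> (\<forall>x\<in>K. f x = k x) \<and>
              preprocessing_queries (chain_order w X f) A \<le> m.
            z ^ card (touched (chain_order w X f) A - K))
         \<le> real (card V) ^ card (X - K) * (1 + z\<^sup>2 * p) ^ m"
proof -
  define N where "N = real (card V)"
  define q where "q = 1 + z\<^sup>2 * p"
  define \<Phi> where "\<Phi> K k = {f \<in> X \<rightarrow>\<^sub>E V. \<forall>x\<in>K. f x = k x}" for K and k :: "'a \<Rightarrow> nat"
  define P where "P f = chain_order w X f" for f
  define D where "D K k m A = {f \<in> \<Phi> K k. preprocessing_queries (P f) A \<le> m}" for K k m A
  define h where "h K A f = z ^ card (touched (P f) A - K)" for K A f
  have q: "q \<ge> 1" using \<open>p \<ge> 0\<close> by (simp add: q_def)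
  have N: "N \<ge> 0" by (simp add: N_def)
  have h0: "h K A f \<ge> 0" for K A f using z by (simp add: h_def)
  have fin\<Phi>: "finite (\<Phi> K k)" for K k
    unfolding \<Phi>_def
    by (rule finite_subset[of _ "X \<rightarrow>\<^sub>E V"]) (use X V in \<open>auto intro!: finite_PiE\<close>)
  then have finD: "finite (D K k m A)" for K k m A by (simp add: D_def)
  have "sum (h K A) (D K k m A) \<le> N ^ card (X - K) * q ^ m"
    using assms(6,7)
  \<comment> \<open>\<open>K\<close> and \<open>k\<close> must vary because a query that meets a
    comparable pair reveals two positions; \<open>m\<close> drops by one with each query.\<close>
  proof (induction A arbitrary: K k m)
    case (Recover r)
    have "card (D K k m (Recover r)) \<le> card V ^ card (X - K)"
      using card_PiE_agreeing_le[OF X V, of K k] by (simp add: D_def \<Phi>_def)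
    then have "real (card (D K k m (Recover r))) \<le> N ^ card (X - K)"
      unfolding N_def by (metis of_nat_le_iff of_nat_power)
    also have "\<dots> \<le> N ^ card (X - K) * q ^ m"
      using q N by (intro mult_le_cancel_left1[THEN iffD2]) (auto simp: one_le_power)
    finally show ?case by (simp add: h_def)
  next
    case (Preprocess x y s t)
    let ?A = "Preprocess x y s t"
    have xy: "x \<in> X" "y \<in> X" "x \<noteq> y" "algorithm_on X s" "algorithm_on X t"
      using Preprocess.prems by auto
    note IHs = Preprocess.IH(1)[OF xy(4)] and IHt = Preprocess.IH(2)[OF xy(5)]
    show ?case
    proof (cases m)
      case 0
      then have "D K k m ?A = {}" by (auto simp: D_def)
      then show ?thesis using N q by (simp only: sum.empty) simp
    next
      case (Suc l)
      define B where "B = N ^ card (X - K) * q ^ l"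
      have B: "B \<ge> 0" "B \<le> N ^ card (X - K) * q ^ m"
        using N q mult_left_mono[of 1 q B] by (auto simp: B_def Suc mult_ac)
      show ?thesis
      \<comment> \<open>With both positions revealed, the answer is fixed and the query touches
        nothing outside \<open>K\<close>, so the whole sum passes to one subtree.\<close>
      proof (cases "x \<in> K \<and> y \<in> K")
        case True
        define r where "r = (if k x \<le> k y \<and> k x mod w = k y mod w then s else t)"
        have *: "f \<in> D K k l r \<and> h K ?A f = h K r f" if "f \<in> D K k m ?A" for f
        proof -
          have "f x = k x" "f y = k y" using that True by (auto simp: D_def \<Phi>_def)
          then have "(x, y) \<in> P f - Id \<longleftrightarrow> k x \<le> k y \<and> k x mod w = k y mod w"
            using xy by (simp add: P_def chain_order_iff)
          then have "preprocessing_queries (P f) ?A = Suc (preprocessing_queries (P f) r)"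
            "touched (P f) ?A - K = touched (P f) r - K"
            using True by (auto simp: r_def)
          then show ?thesis using that by (simp add: D_def h_def Suc)
        qed
        have "sum (h K ?A) (D K k m ?A) = sum (h K r) (D K k m ?A)"
          using * by (intro sum.cong) auto
        also have "\<dots> \<le> sum (h K r) (D K k l r)"
          using * finD h0 by (intro sum_mono2) auto
        also have "\<dots> \<le> B"
          using IHs IHt Preprocess.prems(2) by (simp add: r_def B_def)
        finally show ?thesis using B by simp
      next
        case False
        define same where "same f \<longleftrightarrow> f x mod w = f y mod w" for f :: "'a \<Rightarrow> nat"
        define K' where "K' = insert x (insert y K)"
        have K': "K' \<subseteq> X" using xy Preprocess.prems by (auto simp: K'_def)
        define C where "C = {(u, v) \<in> V \<times> V. u mod w = v mod w \<and>
          (x \<in> K \<longrightarrow> u = k x) \<and> (y \<in> K \<longrightarrow> v = k y)}"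
        have finC: "finite C"
          by (rule finite_subset[of _ "V \<times> V"]) (use V in \<open>auto simp: C_def\<close>)
        define D1 where "D1 = {f \<in> D K k m ?A. same f}"
        define D2 where "D2 = {f \<in> D K k m ?A. \<not> same f}"
        \<comment> \<open>In different classes the answer is \<open>no\<close> and nothing is
          touched. Forgetting that the classes differ only adds nonnegative terms, so
          \<open>K\<close> can stay as it is.\<close>
        have "sum (h K ?A) D2 \<le> B"
        proof -
          have *: "f \<in> D K k l t \<and> h K ?A f = h K t f" if "f \<in> D2" for f
            using that by (auto simp: D2_def D_def P_def chain_order_iff same_def Suc h_def)
          have "sum (h K ?A) D2 = sum (h K t) D2" using * by (intro sum.cong) auto
          also have "\<dots> \<le> sum (h K t) (D K k l t)"
            using * finD h0 by (intro sum_mono2) auto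
          finally show ?thesis using IHt[OF Preprocess.prems(2), of k l] by (simp add: B_def)
        qed
        moreover have "sum (h K ?A) D1 \<le> z\<^sup>2 * p * B"
        proof -
          \<comment> \<open>In the same class the assignments are grouped by the positions of
            \<open>x\<close> and \<open>y\<close>. Within a group the answer is fixed, and both
            elements join the revealed ones.\<close>
          have part: "sum (h K ?A) {f \<in> D1. (f x, f y) = c} \<le> z\<^sup>2 * (N ^ card (X - K') * q ^ l)"
            if "c \<in> C" for c
          proof -
            obtain u v where c: "c = (u, v)" by force
            define k' where "k' = k(x := u, y := v)"
            define r where "r = (if u \<le> v \<and> u mod w = v mod w then s else t)"
            have *: "f \<in> D K' k' l r \<and> h K ?A f \<le> z\<^sup>2 * h K' r f"
              if f: "f \<in> D1" "(f x, f y) = c" for f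
            proof -
              have fxy: "f x = u" "f y = v" using f c by auto
              have "f \<in> \<Phi> K' k'"
                using f fxy xy by (auto simp: D1_def D_def \<Phi>_def K'_def k'_def)
              have "(x, y) \<in> P f - Id \<longleftrightarrow> u \<le> v \<and> u mod w = v mod w"
                using xy fxy by (simp add: P_def chain_order_iff)
              then have 1: "preprocessing_queries (P f) ?A = Suc (preprocessing_queries (P f) r)"
                "touched (P f) ?A \<subseteq> {x, y} \<union> touched (P f) r"
                by (auto simp: r_def)
              have "finite (touched (P f) r)"
                using finite_subset[OF touched_subset X] xy by (simp add: r_def)
              then have "card (touched (P f) ?A - K) \<le> card ({x, y} \<union> (touched (P f) r - K'))"
                using 1 by (intro card_mono) (auto simp: K'_def)
              also have "\<dots> \<le> 2 + card (touched (P f) r - K')"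
                using card_Un_le[of "{x, y}" "touched (P f) r - K'"] xy(3) by simp
              finally have "h K ?A f \<le> z\<^sup>2 * h K' r f"
                unfolding h_def power_add[symmetric] using z by (rule power_increasing)
              moreover have "f \<in> D K' k' l r"
                using f(1) 1(1) \<open>f \<in> \<Phi> K' k'\<close>
                by (simp add: D1_def D_def Suc del: preprocessing_queries.simps)
              ultimately show ?thesis by blast
            qed
            have "sum (h K ?A) {f \<in> D1. (f x, f y) = c} \<le> (\<Sum>f\<in>{f \<in> D1. (f x, f y) = c}. z\<^sup>2 * h K' r f)"
              using * by (intro sum_mono) auto
            also have "\<dots> \<le> (\<Sum>f\<in>D K' k' l r. z\<^sup>2 * h K' r f)"
              using * finD by (intro sum_mono2 mult_nonneg_nonneg h0 zero_le_power2) blast+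
            also have "\<dots> = z\<^sup>2 * sum (h K' r) (D K' k' l r)" by (simp add: sum_distrib_left)
            also have "\<dots> \<le> z\<^sup>2 * (N ^ card (X - K') * q ^ l)"
              using IHs[OF K', of k' l] IHt[OF K', of k' l] by (intro mult_left_mono) (simp_all add: r_def)
            finally show ?thesis .
          qed
          have "(\<lambda>f. (f x, f y)) ` D1 \<subseteq> C"
            using xy by (auto simp: D1_def D_def \<Phi>_def C_def same_def)
          then have "sum (h K ?A) D1 = (\<Sum>c\<in>C. sum (h K ?A) {f \<in> D1. (f x, f y) = c})"
            using finD finC by (intro sum.group[symmetric]) (simp_all add: D1_def)
          also have "\<dots> \<le> (\<Sum>c\<in>C. z\<^sup>2 * (N ^ card (X - K') * q ^ l))"
            by (intro sum_mono part)
          also have "\<dots> = z\<^sup>2 * q ^ l * (real (card C) * N ^ card (X - K'))"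
            by (simp add: mult_ac)
          also have "\<dots> \<le> z\<^sup>2 * q ^ l * (p * N ^ card (X - K))"
            using card_agreeing_classes_le[OF V X Preprocess.prems(2) xy(1-3) False p, of k] q
            by (intro mult_left_mono) (auto simp: C_def N_def K'_def)
          finally show ?thesis by (simp add: B_def mult_ac)
        qed
        moreover have "sum (h K ?A) (D K k m ?A) = sum (h K ?A) D1 + sum (h K ?A) D2"
          using finD unfolding D1_def D2_def
          by (subst sum.union_disjoint[symmetric]) (auto intro!: sum.cong)
        \<comment> \<open>The contributions \<open>B\<close> and \<open>z\<^sup>2 * p * B\<close>
          add up to exactly one further factor \<open>q\<close>.\<close>
        moreover have "N ^ card (X - K) * q ^ m = (1 + z\<^sup>2 * p) * B"
          by (simp add: B_def Suc q_def mult_ac)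
        ultimately show ?thesis by (simp add: distrib_right)
      qed
    qed
  qed
  then show ?thesis
    by (simp add: D_def \<Phi>_def h_def P_def N_def q_def conj_assoc)
qed

text \<open>Markov's inequality for the exponential moment, started with no revealed positions,
  together with \<open>1 + t \<le> exp t\<close>.\<close>

lemma card_touched_gt_le:
  fixes z p s :: real
  assumes z: "z \<ge> 1" and "p \<ge> 0" and X: "finite X" and V: "finite V"
    and p: "\<And>r. real (card {v \<in> V. v mod w = r}) \<le> p * real (card V)"
    and A: "algorithm_on X A"
  shows "real (card {f \<in> X \<rightarrow>\<^sub>E V. preprocessing_queries (chain_order w X f) A \<le> m \<and>
            s < real (card (touched (chain_order w X f) A))}) * z powr s
         \<le> real (card V) ^ card X * exp (real m * (z\<^sup>2 * p))"
proof -
  define D where "D = {f \<in> X \<rightarrow>\<^sub>E V. preprocessing_queries (chain_order w X f) A \<le> m}"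
  define h where "h f = z ^ card (touched (chain_order w X f) A)" for f
  have finD: "finite D"
    unfolding D_def
    by (rule finite_subset[of _ "X \<rightarrow>\<^sub>E V"]) (use X V in \<open>auto intro!: finite_PiE\<close>)
  let ?S = "{f \<in> D. s < real (card (touched (chain_order w X f) A))}"
  have "real (card ?S) * z powr s = (\<Sum>f\<in>?S. z powr s)" by simp
  also have "\<dots> \<le> sum h ?S"
  proof (intro sum_mono)
    fix f assume "f \<in> ?S"
    then have "z powr s \<le> z powr real (card (touched (chain_order w X f) A))"
      using z by (intro powr_mono) auto
    then show "z powr s \<le> h f" using z by (simp add: h_def powr_realpow)
  qed
  also have "\<dots> \<le> sum h D"
    using finD z by (intro sum_mono2) (auto simp: h_def)
  also have "\<dots> \<le> real (card V) ^ card X * (1 + z\<^sup>2 * p) ^ m"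
    using sum_power_card_touched_le[OF assms, of "{}"] by (simp add: D_def h_def)
  also have "\<dots> \<le> real (card V) ^ card X * exp (z\<^sup>2 * p) ^ m"
    using \<open>p \<ge> 0\<close> by (intro mult_left_mono power_mono exp_ge_add_one_self) auto
  finally show ?thesis by (simp add: D_def conj_assoc exp_of_nat_mult)
qed

section \<open>Counting the permutations that an algorithm solves\<close>

text \<open>The order determines the permutation: the position of \<open>x\<close> is the number of
  elements strictly below \<open>x\<close>, and outside \<open>{..<n}\<close> a permutation is the
  identity.\<close>

lemma inj_on_position_order:
  "inj_on (position_order {..<n}) {f. f permutes {..<n}}"
proof (rule inj_onI)
  fix f g :: "nat \<Rightarrow> nat"
  assume f: "f \<in> {f. f permutes {..<n}}" and g: "g \<in> {f. f permutes {..<n}}"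
    and eq: "position_order {..<n} f = position_order {..<n} g"
  have rank: "h x = card {y \<in> {..<n}. (x, y) \<notin> position_order {..<n} h}"
    if h: "h permutes {..<n}" and x: "x < n" for h :: "nat \<Rightarrow> nat" and x
  proof -
    have "h x < n" using permutes_in_image[OF h, of x] x by simp
    have "h ` {y \<in> {..<n}. h y < h x} = {..<h x}"
    proof
      show "{..<h x} \<subseteq> h ` {y \<in> {..<n}. h y < h x}"
      proof
        fix v assume v: "v \<in> {..<h x}"
        then have "v \<in> h ` {..<n}" using permutes_image[OF h] \<open>h x < n\<close> by simp
        then show "v \<in> h ` {y \<in> {..<n}. h y < h x}" using v by auto
      qed
    qed auto
    moreover have "inj_on h {y \<in> {..<n}. h y < h x}"
      using permutes_inj[OF h] by (rule inj_on_subset) simp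
    ultimately have "card {y \<in> {..<n}. h y < h x} = h x"
      by (metis card_image card_lessThan)
    moreover have "{y \<in> {..<n}. (x, y) \<notin> position_order {..<n} h} = {y \<in> {..<n}. h y < h x}"
      using x by (auto simp: position_order_def)
    ultimately show ?thesis by simp
  qed
  show "f = g"
  proof
    fix x show "f x = g x"
    proof (cases "x < n")
      case True
      then show ?thesis using rank[of f x] rank[of g x] f g by (metis eq mem_Collect_eq)
    next
      case False
      then show ?thesis using f g permutes_not_in[of f "{..<n}" x] permutes_not_in[of g "{..<n}" x] by simp
    qed
  qed
qed

text \<open>The first summand bounds the permutations with more than \<open>n / 4\<close> touched
  elements; it has \<open>n ^ n\<close> instead of \<open>fact n\<close> because the tail bound runs
  over all maps. The second bounds the others, by outcomes of preprocessing times reachable reports.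
  The parameter \<open>z\<close> is left free for optimization.\<close>

lemma card_solved_le:
  fixes z a b :: real
  assumes n: "n > 0" and w: "0 < w" "w \<le> n" and z: "z \<ge> 1" and a: "a \<ge> 0" and b: "b \<ge> 0"
    and A: "algorithm_on {..<n} A"
  shows "real (card {f. f permutes {..<n} \<and>
            solves_within a b A (chain_order w {..<n} f) (position_order {..<n} f)})
         \<le> real n ^ n * exp (a * (z\<^sup>2 * (2 / real w))) / z powr (real n / 4)
           + 2 ^ n * real n powr (real n / 4) * 2 powr b"
proof -
  define X where "X = {..<n}"
  define P where "P f = chain_order w X f" for f
  define L where "L f = position_order X f" for f
  define m where "m = nat \<lfloor>a\<rfloor>"
  define k where "k = nat \<lfloor>b\<rfloor>"
  define S1 where "S1 = {f. f permutes X \<and> preprocessing_queries (P f) A \<le> m \<and>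
    real n / 4 < real (card (touched (P f) A))}"
  define S2 where "S2 = {f. f permutes X \<and> card (touched (P f) A) \<le> n div 4 \<and>
    recovery_queries (P f) (L f) (preprocessed (P f) A) \<le> k \<and>
    recovered (P f) (L f) (preprocessed (P f) A) = L f}"
  have finX: "finite X" "card X = n" by (auto simp: X_def)
  have finPerm: "finite {f. f permutes X}" using finX by (simp add: finite_permutations)
  have PL_restrict: "P (restrict f X) = P f" for f by (simp add: P_def)
  have restr: "restrict f X \<in> X \<rightarrow>\<^sub>E {..<n}" if "f permutes X" for f
    using permutes_in_image[OF that] by (auto simp: X_def)

  \<comment> \<open>Restriction embeds the permutations into the maps
    \<open>X \<rightarrow>\<^sub>E {..<n}\<close>, which are undefined outside \<open>X\<close>
    where permutations are the identity.\<close>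
  have inj: "inj_on (\<lambda>f. restrict f X) {f. f permutes X}"
  proof (rule inj_onI)
    fix f g assume fg: "f \<in> {f. f permutes X}" "g \<in> {f. f permutes X}" "restrict f X = restrict g X"
    show "f = g"
    proof
      fix x
      have "restrict f X x = restrict g X x" using fg(3) by simp
      then show "f x = g x"
        using fg(1,2) permutes_not_in[of f X x] permutes_not_in[of g X x]
        by (cases "x \<in> X") auto
    qed
  qed
  let ?T = "{f \<in> X \<rightarrow>\<^sub>E {..<n}. preprocessing_queries (chain_order w X f) A \<le> m \<and>
            real n / 4 < real (card (touched (chain_order w X f) A))}"
  have "card S1 \<le> card ?T"
  proof (rule card_inj_on_le)
    show "inj_on (\<lambda>f. restrict f X) S1" by (rule inj_on_subset[OF inj]) (auto simp: S1_def)
    show "(\<lambda>f. restrict f X) ` S1 \<subseteq> ?T"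
    proof (rule image_subsetI)
      fix f assume "f \<in> S1"
      then show "restrict f X \<in> ?T" using restr[of f] by (simp add: S1_def P_def)
    qed
    show "finite ?T"
      by (rule finite_subset[of _ "X \<rightarrow>\<^sub>E {..<n}"]) (use finX in \<open>auto intro!: finite_PiE\<close>)
  qed
  then have "real (card S1) * z powr (real n / 4) \<le> real (card ?T) * z powr (real n / 4)"
    by (intro mult_right_mono) auto
  also have "\<dots> \<le> real (card {..<n}) ^ card X * exp (real m * (z\<^sup>2 * (2 / real w)))"
    using A w z card_chain_class_le[OF w] finX(1)
    by (intro card_touched_gt_le) (auto simp: X_def)
  also have "\<dots> \<le> real n ^ n * exp (a * (z\<^sup>2 * (2 / real w)))"
    using a finX(2) by (auto simp: m_def intro!: mult_left_mono mult_right_mono divide_right_mono)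
  finally have S1: "real (card S1) \<le> real n ^ n * exp (a * (z\<^sup>2 * (2 / real w))) / z powr (real n / 4)"
    using z by (simp add: pos_le_divide_eq)

  define R where "R = {preprocessed (P f) A | f. f \<in> X \<rightarrow>\<^sub>E {..<n} \<and> card (touched (P f) A) \<le> n div 4}"
  define Q where "Q r = {recovered P L r | P L. recovery_queries P L r \<le> k}" for r :: "nat recovery"
  have R: "finite R" "card R \<le> 2 ^ n * n ^ (n div 4)"
    using card_preprocessed_le[OF finX(1) _ n, of A w "n div 4"] A finX(2)
    by (simp_all add: R_def P_def X_def)
  have Q: "finite (Q r)" "card (Q r) \<le> 2 ^ k" for r
    using card_recovered_le[of r k] by (simp_all add: Q_def)
  \<comment> \<open>On \<open>S2\<close> the report is correct, so \<open>L f\<close> is among the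
    reports reachable from the outcome of preprocessing, and distinct permutations need distinct
    reports.\<close>
  have "card S2 \<le> card (\<Union>r\<in>R. Q r)"
  proof (rule card_inj_on_le)
    have "L = position_order {..<n}" by (simp add: fun_eq_iff L_def X_def)
    then show "inj_on L S2"
      using inj_on_position_order[of n] by (auto simp: S2_def X_def elim: inj_on_subset)
    show "L ` S2 \<subseteq> (\<Union>r\<in>R. Q r)"
    proof (intro image_subsetI UN_I)
      fix f assume f: "f \<in> S2"
      show "preprocessed (P f) A \<in> R"
        unfolding R_def using f restr[of f] PL_restrict[of f]
        by (intro CollectI exI[of _ "restrict f X"]) (simp add: S2_def)
      show "L f \<in> Q (preprocessed (P f) A)"
        unfolding Q_def using f
        by (intro CollectI exI[of _ "P f"] exI[of _ "L f"]) (simp add: S2_def)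
    qed
    show "finite (\<Union>r\<in>R. Q r)" using R Q by blast
  qed
  also have "\<dots> \<le> (\<Sum>r\<in>R. card (Q r))" using R(1) by (rule card_UN_le)
  also have "\<dots> \<le> card R * 2 ^ k" using sum_bounded_above[of R "\<lambda>r. card (Q r)"] Q by simp
  also have "\<dots> \<le> 2 ^ n * n ^ (n div 4) * 2 ^ k" using R by simp
  finally have "real (card S2) \<le> real (2 ^ n * n ^ (n div 4) * 2 ^ k)" by (rule of_nat_mono)
  also have "\<dots> = 2 ^ n * real n powr (real (n div 4)) * 2 powr real k"
    using n by (simp add: powr_realpow)
  also have "\<dots> \<le> 2 ^ n * real n powr (real n / 4) * 2 powr b"
    using n b of_nat_div_le_of_nat[of n 4, where 'a = real]
    by (intro mult_mono powr_mono) (auto simp: k_def)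
  finally have S2: "real (card S2) \<le> 2 ^ n * real n powr (real n / 4) * 2 powr b" .

  have "{f. f permutes X \<and> solves_within a b A (P f) (L f)} \<subseteq> S1 \<union> S2"
  proof
    fix f assume f: "f \<in> {f. f permutes X \<and> solves_within a b A (P f) (L f)}"
    show "f \<in> S1 \<union> S2"
    proof (cases "real n / 4 < real (card (touched (P f) A))")
      case True
      with f show ?thesis by (auto simp: S1_def solves_within_def m_def le_nat_floor)
    next
      case False
      then have "card (touched (P f) A) \<le> n div 4" by linarith
      with f show ?thesis by (auto simp: S2_def solves_within_def k_def le_nat_floor)
    qed
  qed
  moreover have "finite S1" "finite S2"
    using finPerm by (auto simp: S1_def S2_def intro: finite_subset[rotated])
  ultimately have "card {f. f permutes X \<and> solves_within a b A (P f) (L f)} \<le> card S1 + card S2"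
    by (meson card_Un_le card_mono finite_UnI order_trans)
  then have "real (card {f. f permutes X \<and> solves_within a b A (P f) (L f)})
      \<le> real (card S1) + real (card S2)" by linarith
  then show ?thesis using S1 S2 unfolding P_def L_def X_def by linarith
qed

section \<open>Numerical estimates\<close>

text \<open>A single term of the exponential series at \<open>n\<close> is at most the whole
  sum.\<close>

lemma power_le_fact_mult_exp: "real n ^ n \<le> fact n * exp (real n)"
proof -
  have "(\<Sum>k\<in>{n}. inverse (fact k) * real n ^ k) \<le> (\<Sum>k. inverse (fact k) * real n ^ k)"
    by (intro sum_le_suminf summable_exp) auto
  then have "inverse (fact n) * real n ^ n \<le> exp (real n)"
    by (simp add: exp_def scaleR_conv_of_real)
  then show ?thesis by (simp add: field_simps)
qed

text \<open>With \<open>z\<^sup>2\<close> equal to \<open>n\<close> to the power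
  \<open>1 / c\<close>, the exponent \<open>a * (z\<^sup>2 * (2 / real w))\<close> is at most
  \<open>n / 24\<close>, while the gain \<open>z powr (n / 4)\<close> is
  \<open>exp (n * ln n / (8 * c))\<close> and wins once \<open>ln n \<ge> 100 * c\<close>. In the
  second summand \<open>n * ln n\<close> has coefficient at most \<open>1 / 4 + 2 / 73\<close>. Each
  summand gets half of the allowed quarter.\<close>

lemma bounds_le_fact:
  fixes c :: real and n w :: nat
  assumes c: "c \<ge> 3" and n: "real n \<ge> exp (100 * c)"
    and w: "real w \<ge> real n powr (2 / c)" "real w \<le> 2 * real n powr (2 / c)"
  defines "a \<equiv> 1 / 48 * real n powr (1 + 1 / c)" and "z \<equiv> real n powr (1 / (2 * c))"
    and "b \<equiv> 1 / 73 * c * (real n * log 2 (real w))"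
  shows "real n ^ n * exp (a * (z\<^sup>2 * (2 / real w))) / z powr (real n / 4)
           + 2 ^ n * real n powr (real n / 4) * 2 powr b \<le> fact n / 4"
proof -
  define l where "l = ln (real n)"
  define N where "N = real n"
  have "1 \<le> exp (100 * c)" using c by simp
  then have N1: "N \<ge> 1" using n unfolding N_def by linarith
  have npos: "real n > 0" using N1 by (simp add: N_def)
  have l: "l \<ge> 100 * c" unfolding l_def using n npos by (simp add: ln_ge_iff)
  have powr_exp: "real n powr t = exp (t * l)" for t
    using npos by (simp add: powr_def l_def)
  have nn: "real n ^ n = exp (N * l)"
    using powr_realpow[OF npos, of n] by (simp add: powr_exp N_def)
  have fact: "exp (N * l - N) \<le> fact n"
    using power_le_fact_mult_exp[of n] by (simp add: nn exp_diff N_def field_simps)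
  have ln2: "0 \<le> ln (2::real)" "ln (2::real) \<le> 1" using ln_2_less_1 by auto
  have eight: "8 \<le> exp (3 * N)"
  proof -
    have "(2::real) ^ 3 \<le> exp N ^ 3"
      using exp_ge_add_one_self[of N] N1 by (intro power_mono) linarith+
    also have "\<dots> = exp (3 * N)" using exp_of_nat_mult[of 3 N] by simp
    finally show ?thesis by simp
  qed
  \<comment> \<open>Of the \<open>4 * N\<close>, one \<open>N\<close> pays for \<open>fact n\<close>
    against \<open>n ^ n\<close> and three pay for the factor 8.\<close>
  have key: "exp t \<le> fact n / 8" if "t \<le> N * l - 4 * N" for t
  proof -
    have "8 * exp t \<le> exp (3 * N) * exp t" using eight by simp
    also have "\<dots> \<le> exp (N * l - N)" using that by (simp add: exp_add[symmetric])
    finally show ?thesis using fact by simp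
  qed

  have "real n powr (2 / c) > 0" using npos by simp
  then have wpos: "real w > 0" using w(1) by linarith
  have "a * (z\<^sup>2 * (2 / real w)) \<le> a * (z\<^sup>2 * (2 / real n powr (2 / c)))"
    using w npos wpos by (intro mult_left_mono divide_left_mono) (auto simp: a_def)
  also have "\<dots> = N / 24"
  proof -
    have "real n powr (1 + 1 / c) * z\<^sup>2 / real n powr (2 / c) = exp ((1 + 1 / c) * l + 2 * (1 / (2 * c) * l) - 2 / c * l)"
      unfolding z_def powr_exp by (simp only: exp_diff exp_add exp_double)
    also have "(1 + 1 / c) * l + 2 * (1 / (2 * c) * l) - 2 / c * l = l"
      using c by (simp add: field_simps)
    also have "exp l = N" using npos by (simp add: l_def N_def)
    finally show ?thesis by (simp add: a_def mult.commute)
  qed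
  also have "\<dots> \<le> N" using N1 by simp
  finally have ex: "exp (a * (z\<^sup>2 * (2 / real w))) \<le> exp N" by simp
  have zz: "z powr (real n / 4) = exp (N * l / (8 * c))"
    unfolding z_def powr_powr unfolding powr_exp by (simp add: N_def field_simps)
  have "real n ^ n * exp (a * (z\<^sup>2 * (2 / real w))) / z powr (real n / 4)
      \<le> exp (N * l) * exp N / exp (N * l / (8 * c))"
    unfolding nn zz using ex by (intro divide_right_mono mult_left_mono) auto
  also have "\<dots> = exp (N * l + N - N * l / (8 * c))" by (simp add: exp_add exp_diff)
  also have "\<dots> \<le> fact n / 8"
  proof (rule key)
    \<comment> \<open>One \<open>N\<close> comes from the tail bound and four from
      \<open>key\<close>; \<open>l \<ge> 100 * c\<close> makes the quotient at least 12.5.\<close>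
    have "5 * N \<le> N * (l / (8 * c))"
      using l c N1 by (subst mult.commute) (intro mult_left_mono, auto simp: field_simps)
    then show "N * l + N - N * l / (8 * c) \<le> N * l - 4 * N" by simp
  qed
  finally have T1: "real n ^ n * exp (a * (z\<^sup>2 * (2 / real w))) / z powr (real n / 4) \<le> fact n / 8" .

  have "ln (real w) \<le> ln (2 * real n powr (2 / c))" using w(2) wpos npos by (subst ln_le_cancel_iff) auto
  also have "\<dots> = ln 2 + 2 / c * l" using npos by (simp add: ln_mult l_def ln_powr)
  finally have lnw: "ln (real w) \<le> 1 + 2 / c * l" using ln2 by simp
  have "2 powr b = exp (c / 73 * (N * ln (real w)))"
    by (simp add: powr_def b_def log_def N_def)
  also have "\<dots> \<le> exp (c / 73 * (N * (1 + 2 / c * l)))"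
    using lnw c N1 by (simp add: mult_left_mono)
  also have "c / 73 * (N * (1 + 2 / c * l)) = N * (c / 73 + 2 / 73 * l)"
    using c by (simp add: field_simps)
  finally have pb: "2 powr b \<le> exp (N * (c / 73 + 2 / 73 * l))" .
  have "(2::real) ^ n \<le> exp 1 ^ n" using exp_ge_add_one_self[of 1] by (intro power_mono) auto
  then have p2: "(2::real) ^ n \<le> exp N" by (simp add: N_def exp_of_nat_mult[symmetric])
  have "2 ^ n * real n powr (real n / 4) * 2 powr b
      \<le> exp N * exp (N / 4 * l) * exp (N * (c / 73 + 2 / 73 * l))"
    using p2 pb by (intro mult_mono) (auto simp: powr_exp N_def)
  also have "\<dots> = exp (N * (1 + l / 4 + (c / 73 + 2 / 73 * l)))"
    by (simp add: exp_add[symmetric] algebra_simps)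
  also have "\<dots> \<le> fact n / 8"
  proof (rule key)
    \<comment> \<open>Since \<open>l \<ge> 100 * c \<ge> 300\<close>, the part of \<open>l\<close>
      left over by \<open>1 / 4 + 2 / 73\<close> absorbs \<open>c / 73\<close> and the
      constants.\<close>
    have "N * (1 + l / 4 + (c / 73 + 2 / 73 * l)) \<le> N * (l - 4)"
      using l c N1 by (intro mult_left_mono) auto
    then show "N * (1 + l / 4 + (c / 73 + 2 / 73 * l)) \<le> N * l - 4 * N"
      by (simp add: algebra_simps)
  qed
  finally show ?thesis using T1 by linarith
qed

section \<open>The family of instances and the lower bound\<close>

text \<open>The family is fixed before the algorithm, so the bound also covers algorithms tailored
  to \<open>n\<close>, \<open>c\<close> and \<open>F\<close>. It is the image of all permutations of
  \<open>n\<close> positions.\<close>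

theorem theorem3:
  fixes c :: real
  assumes "c \<ge> 3"
  shows "\<exists>n\<^sub>0::nat. \<forall>n\<ge>n\<^sub>0. \<exists>(X::nat set) F.
           finite X \<and> card X = n \<and> F \<noteq> {} \<and> finite F \<and> F \<subseteq> instances X \<and>
           \<not> (\<exists>A. algorithm_on X A \<and>
                real (card {(P, L) \<in> F.
                  solves_within (1 / 48 * real n powr (1 + 1 / c))
                    (1 / 73 * c * log 2 (real (num_linear_extensions X P))) A P L})
                > 1 / 4 * real (card F))"
proof (intro exI[of _ "nat \<lceil>exp (100 * c)\<rceil>"] allI impI)
  fix n assume "nat \<lceil>exp (100 * c)\<rceil> \<le> n"
  then have n: "real n \<ge> exp (100 * c)" by linarith
  then have n1: "real n \<ge> 1"
    using assms one_le_exp_iff[of "100 * c"] by linarith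
  define X where "X = {..<n}"
  define y where "y = real n powr (2 / c)"
  \<comment> \<open>Since \<open>1 \<le> y \<le> n\<close>, rounding up at most doubles
    \<open>y\<close> and keeps \<open>w\<close> within \<open>n\<close>.\<close>
  define w where "w = nat \<lceil>y\<rceil>"
  have y: "1 \<le> y" "y \<le> real n"
    using n1 assms powr_mono[of "2 / c" 1 "real n"] by (auto simp: y_def ge_one_powr_ge_zero)
  then have w: "y \<le> real w" "real w \<le> 2 * y" "0 < w" "w \<le> n"
    unfolding w_def by linarith+
  define E where "E f = (chain_order w X f, position_order X f)" for f
  define F where "F = E ` {f. f permutes X}"
  have finP: "finite {f. f permutes X}" by (simp add: X_def finite_permutations)
  have cardF: "card F = fact n"
  proof -
    have "inj_on E {f. f permutes X}"
      using inj_on_position_order[of n] by (auto simp: E_def X_def inj_on_def)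
    then show ?thesis by (simp add: F_def card_image card_permutations X_def)
  qed
  have inst: "F \<subseteq> instances X"
    unfolding F_def E_def
    by (intro image_subsetI chain_position_in_instances) (auto intro: permutes_inj_on)
  have "\<not> real (card {(P, L) \<in> F. solves_within (1 / 48 * real n powr (1 + 1 / c))
          (1 / 73 * c * log 2 (real (num_linear_extensions X P))) A P L}) > 1 / 4 * real (card F)"
    if A: "algorithm_on X A" for A
  proof -
    define a where "a = 1 / 48 * real n powr (1 + 1 / c)"
    define b where "b = 1 / 73 * c * (real n * log 2 (real w))"
    let ?S = "{f. f permutes X \<and> solves_within a b A (chain_order w X f) (position_order X f)}"
    \<comment> \<open>The recovery budget depends on \<open>P\<close>;
      \<open>e(P) \<le> w ^ n\<close> replaces it by one budget \<open>b\<close> for the whole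
      family.\<close>
    have bound: "1 / 73 * c * log 2 (real (num_linear_extensions X (chain_order w X f))) \<le> b" for f
    proof -
      let ?e = "num_linear_extensions X (chain_order w X f)"
      have e: "?e \<le> w ^ n"
        using card_linear_extensions_chain_order_le[of X w f] w(3)
        by (simp add: num_linear_extensions_def X_def)
      have "log 2 (real ?e) \<le> log 2 (real (w ^ n))"
      proof (cases "?e = 0")
        \<comment> \<open>A non-injective \<open>f\<close> may admit no linear extension; the
          logarithm of 0 is then 0 by convention.\<close>
        case True
        then show ?thesis using w(3) by (simp add: log_def)
      next
        case False
        then show ?thesis using of_nat_mono[OF e, where 'a = real] w(3) by (subst log_le_cancel_iff) auto
      qed
      also have "\<dots> = real n * log 2 (real w)" using w(3) by (simp add: log_nat_power)
      finally show ?thesis unfolding b_def using assms by (intro mult_left_mono) auto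
    qed
    have "{(P, L) \<in> F. solves_within a (1 / 73 * c * log 2 (real (num_linear_extensions X P))) A P L}
        \<subseteq> E ` ?S"
    proof clarify
      fix P L assume "(P, L) \<in> F"
        and s: "solves_within a (1 / 73 * c * log 2 (real (num_linear_extensions X P))) A P L"
      then obtain f where f: "f permutes X" "P = chain_order w X f" "L = position_order X f"
        by (auto simp: F_def E_def)
      have "solves_within a b A P L"
        using s bound[of f] order_trans unfolding solves_within_def f(2) by blast
      then show "(P, L) \<in> E ` ?S" using f by (auto simp: E_def)
    qed
    moreover have "finite ?S" using finP by (rule finite_subset[rotated]) auto
    ultimately have "card {(P, L) \<in> F. solves_within a (1 / 73 * c * log 2 (real (num_linear_extensions X P))) A P L}
        \<le> card ?S"
      by (rule surj_card_le[rotated])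
    also have "real (card ?S) \<le> fact n / 4"
    proof -
      have "b \<ge> 0" using w(3) assms by (auto simp: b_def intro!: mult_nonneg_nonneg zero_le_log_cancel_iff[THEN iffD2])
      moreover have "real n powr (1 / (2 * c)) \<ge> 1"
        using n1 assms by (intro ge_one_powr_ge_zero) auto
      ultimately have "real (card ?S) \<le> real n ^ n *
            exp (a * ((real n powr (1 / (2 * c)))\<^sup>2 * (2 / real w))) / (real n powr (1 / (2 * c))) powr (real n / 4)
          + 2 ^ n * real n powr (real n / 4) * 2 powr b"
        using w(3,4) n1 A unfolding X_def by (intro card_solved_le) (auto simp: a_def)
      also have "\<dots> \<le> fact n / 4"
        unfolding a_def b_def by (intro bounds_le_fact assms n w(1,2)[unfolded y_def])
      finally show ?thesis .
    qed
    finally show ?thesis using cardF by (simp add: a_def)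
  qed
  moreover have "F \<noteq> {}" "finite F"
    using cardF by (auto intro: card_ge_0_finite)
  ultimately show "\<exists>(X::nat set) F.
           finite X \<and> card X = n \<and> F \<noteq> {} \<and> finite F \<and> F \<subseteq> instances X \<and>
           \<not> (\<exists>A. algorithm_on X A \<and>
                real (card {(P, L) \<in> F.
                  solves_within (1 / 48 * real n powr (1 + 1 / c))
                    (1 / 73 * c * log 2 (real (num_linear_extensions X P))) A P L})
                > 1 / 4 * real (card F))"
    using inst by (intro exI[of _ X] exI[of _ F]) (auto simp: X_def)
qed

end
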